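(* Let $n_Q\ge1$ be an integer, $v$ a parameter, $g_Q$ a function as in the context, and $z_i,z_j$ nonzero parameters. Fix decorated spins $\sigma,\tau,\theta,\rho\in D$ and spins $\alpha,\beta\in\{+,-\}$. Then, with the weights $T_z$ and $R_{z_i,z_j}$ of the context, $$\sum_{\nu,\mu\in D,\ \gamma\in\{+,-\}} R_{z_i,z_j}(\tau,\sigma;\nu,\mu)\,T_{z_j}(\nu,\beta;\theta,\gamma)\,T_{z_i}(\mu,\gamma;\rho,\alpha)$$ $$=\sum_{\phi,\psi\in D,\ \delta\in\{+,-\}} T_{z_i}(\tau,\beta;\phi,\delta)\,T_{z_j}(\sigma,\delta;\psi,\alpha)\,R_{z_i,z_j}(\phi,\psi;\theta,\rho).$$ (The left side is the partition function of the system consisting of an $R$-vertex attached on the left of two vertically stacked vertices, the top one with parameter $z_j$ and the bottom one with parameter $z_i$; the right side is the partition function of two stacked vertices, the top one with parameter $z_i$ and the bottom one with $z_j$, with the $R$-vertex attached on the right; the boundary edges are labelled $\sigma$ bottom-left, $\tau$ top-left, $\beta$ top, $\theta$ top-right, $\rho$ bottom-right, $\alpha$ bottom.)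
   Context: Decorated spins: $D=\{-0,+1,+2,\dots,+n_Q\}$, labels of horizontal edges; the decoration is an integer mod $n_Q$ (so $+0$ means $+n_Q$), spin $-$ only carries decoration $0$, and decorations of $+$ spins are compared using representatives in $\{1,\dots,n_Q\}$. Vertical edges carry undecorated spins $\pm$. $g_Q:\mathbb Z\to\mathbb C$ is any function periodic mod $n_Q$ with $g_Q(0)=-v$ and $g_Q(t)g_Q(n_Q-t)=v$ for $t\not\equiv0\pmod{n_Q}$. $\delta(a)=1$ if $a\equiv0\pmod{n_Q}$ and $0$ otherwise. Vertex weights $T_z(\ell,t;r,d)$, with $\ell$ = left edge, $t$ = top edge, $r$ = right edge, $d$ = bottom edge: $T_z(+(a+1),+;+a,+)=z^{-n_Q\delta(a)}$; $T_z(-0,-;-0,-)=1$; $T_z(+(a+1),-;+a,-)=g_Q(a)z^{-n_Q\delta(a)}$; $T_z(-0,+;-0,+)=1$; $T_z(-0,+;+0,-)=(1-v)z^{-n_Q}$; $T_z(+1,-;-0,+)=1$; all other values are $0$ ($a$ ranges over integers mod $n_Q$). $R$-vertex weights $R_{z_i,z_j}(p,s;t,u)$, with $p$ = top-left, $s$ = bottom-left, $t$ = top-right, $u$ = bottom-right edge (the $z_i$ strand runs from top-left to bottom-right, the $z_j$ strand from bottom-left to top-right). Put $x=(z_i/z_j)^{n_Q}$ (assume $1-vx\ne0$); for $a,b\in\{1,\dots,n_Q\}$, $a\ne b$: $R(+a,+a;+a,+a)=\frac{-v+x}{1-vx}$; $R(+a,+b;+b,+a)=g_Q(a-b)\frac{1-x}{1-vx}$;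 $R(+a,+b;+a,+b)=\frac{1-v}{1-vx}\cdot x$ if $a>b$, and $\frac{1-v}{1-vx}$ if $a<b$; $R(-0,-0;-0,-0)=1$; $R(-0,+a;+a,-0)=\frac{v(1-x)}{1-vx}$; $R(+a,-0;-0,+a)=\frac{1-x}{1-vx}$; $R(+a,-0;+a,-0)=\frac{(1-v)x}{1-vx}$; $R(-0,+a;-0,+a)=\frac{1-v}{1-vx}$; all other values are $0$. *)

theory Defs
  imports Complex_Main "HOL-Number_Theory.Cong"
begin

datatype spin = Plus_spin | Minus_spin

text \<open>
  Vertical edges carry a \<open>spin\<close>, horizontal edges a \<open>dspin\<close>. \<open>Minus_dec\<close> is the label $-0$, and \<open>Plus_dec a\<close> is the label $+a$.
  A decoration modulo \<open>n\<close> is given by its representative in \<open>{1..n}\<close>, so $+0$ is \<open>Plus_dec n\<close>.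
\<close>

datatype dspin = Minus_dec | Plus_dec int

definition dspins :: "nat \<Rightarrow> dspin set" where
  "dspins n = insert Minus_dec (Plus_dec ` {1..int n})"

definition divind :: "nat \<Rightarrow> int \<Rightarrow> int" where
  "divind n a = (if [a = 0] (mod int n) then 1 else 0)"

text \<open>
  \<open>T_weight n v g z l t r d\<close> has left edge \<open>l\<close>, top edge \<open>t\<close>, right edge \<open>r\<close>
  and bottom edge \<open>d\<close>. Decorations are compared modulo \<open>n\<close>.
\<close>

fun T_weight ::
  "nat \<Rightarrow> complex \<Rightarrow> (int \<Rightarrow> complex) \<Rightarrow> complex \<Rightarrow> dspin \<Rightarrow> spin \<Rightarrow> dspin \<Rightarrow> spin \<Rightarrow> complex"
where
  "T_weight n v g z (Plus_dec b) Plus_spin (Plus_dec a) Plus_spin =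
     (if [b = a + 1] (mod int n) then z powi (- (int n * divind n a)) else 0)"
| "T_weight n v g z Minus_dec Minus_spin Minus_dec Minus_spin = 1"
| "T_weight n v g z (Plus_dec b) Minus_spin (Plus_dec a) Minus_spin =
     (if [b = a + 1] (mod int n) then g a * z powi (- (int n * divind n a)) else 0)"
| "T_weight n v g z Minus_dec Plus_spin Minus_dec Plus_spin = 1"
| "T_weight n v g z Minus_dec Plus_spin (Plus_dec a) Minus_spin =
     (if [a = 0] (mod int n) then (1 - v) * z powi (- int n) else 0)"
| "T_weight n v g z (Plus_dec b) Minus_spin Minus_dec Plus_spin =
     (if [b = 1] (mod int n) then 1 else 0)"
| "T_weight n v g z _ _ _ _ = 0"

text \<open>
  \<open>R_weight n v g zi zj p s t u\<close> has top-left edge \<open>p\<close>, bottom-left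
  edge \<open>s\<close>, top-right edge \<open>t\<close> and bottom-right edge \<open>u\<close>. It is meant for labels in
  \<open>dspins n\<close>: decorations are compared as representatives in \<open>{1..n}\<close>.
\<close>

fun R_weight ::
  "nat \<Rightarrow> complex \<Rightarrow> (int \<Rightarrow> complex) \<Rightarrow> complex \<Rightarrow> complex \<Rightarrow>
     dspin \<Rightarrow> dspin \<Rightarrow> dspin \<Rightarrow> dspin \<Rightarrow> complex"
where
  "R_weight n v g zi zj (Plus_dec a) (Plus_dec b) (Plus_dec c) (Plus_dec d) =
     (let x = (zi / zj) ^ n in
      if a = b \<and> c = a \<and> d = a then (- v + x) / (1 - v * x)
      else if a \<noteq> b \<and> c = b \<and> d = a then g (a - b) * ((1 - x) / (1 - v * x))
      else if a > b \<and> c = a \<and> d = b then (1 - v) / (1 - v * x) * x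
      else if a < b \<and> c = a \<and> d = b then (1 - v) / (1 - v * x)
      else 0)"
| "R_weight n v g zi zj Minus_dec Minus_dec Minus_dec Minus_dec = 1"
| "R_weight n v g zi zj Minus_dec (Plus_dec a) (Plus_dec b) Minus_dec =
     (let x = (zi / zj) ^ n in if a = b then v * (1 - x) / (1 - v * x) else 0)"
| "R_weight n v g zi zj (Plus_dec a) Minus_dec Minus_dec (Plus_dec b) =
     (let x = (zi / zj) ^ n in if a = b then (1 - x) / (1 - v * x) else 0)"
| "R_weight n v g zi zj (Plus_dec a) Minus_dec (Plus_dec b) Minus_dec =
     (let x = (zi / zj) ^ n in if a = b then (1 - v) * x / (1 - v * x) else 0)"
| "R_weight n v g zi zj Minus_dec (Plus_dec a) Minus_dec (Plus_dec b) =
     (let x = (zi / zj) ^ n in if a = b then (1 - v) / (1 - v * x) else 0)"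
| "R_weight n v g zi zj _ _ _ _ = 0"

end

theory Submission
  imports Defs
begin

text \<open>
  The identity is a finite collection of rational function identities, and three observations make
  that collection independent of \<open>n\<close>.

  First, an \<open>R\<close>-vertex conserves its pair of labels: its right labels are its left labels, either
  kept on their rows or exchanged (\<open>R_weight_conserves\<close>). Each of the two double sums over horizontal
  labels therefore has at most two nonzero terms (\<open>sum_R_left\<close>, \<open>sum_R_right\<close>).

  Second, a \<open>T\<close>-vertex lowers a decoration by one, cyclically. If the labels on the left boundary are
  written as cyclic successors \<open>+(a+1)\<close>, every nonvanishing condition becomes either an equality of
  labels in \<open>{1..n}\<close> or the statement that a label is the representative \<open>n\<close> of \<open>0\<close>
  (\<open>T_weight_plus\<close>, \<open>T_weight_mixed\<close>). The differences on which \<open>g\<close> is evaluated are not affected by the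
  shift, but the order of two labels is: the shift reverses it exactly when one of them is \<open>n\<close>
  (\<open>cyc_succ_less_iff\<close>). That reversal exchanges the two weights \<open>(1 - v) x / (1 - v x)\<close> and
  \<open>(1 - v) / (1 - v x)\<close>, whose quotient is \<open>x = zi^n / zj^n\<close>; the label \<open>n\<close> is also the one that
  carries the factor \<open>z^(-n)\<close>, and moving that factor between the rows compensates for it.

  Third, \<open>g\<close> enters only through \<open>g n = - v\<close>, its periodicity, and the relation \<open>g a * g (n - a) = v\<close>.
  The last one is needed when one strand stays \<open>+\<close>, the other passes from \<open>-\<close> to \<open>+0\<close> or from \<open>+1\<close>
  to \<open>-\<close>, and they exchange rows. On one side of the identity they cross as two \<open>+\<close> labels, on the
  other as a \<open>-\<close> and a \<open>+\<close>. For one vertical order of the strands the crossing weights are proportional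
  to \<open>g (n - a)\<close>, next to a factor \<open>g a\<close> from a \<open>T\<close>-vertex, and to \<open>v\<close>; for the other order both sides
  are proportional to \<open>g a\<close>.

  What remains is checked sector by sector, according to the signs of the two left labels, by clearing
  the denominators \<open>x\<close>, \<open>zj^n\<close> and \<open>1 - v x\<close>.
\<close>

section \<open>Conservation of labels at an R-vertex\<close>

lemma R_weight_conserves:
  assumes "R_weight n v g zi zj p s t u \<noteq> 0"
  shows "(t, u) = (p, s) \<or> (t, u) = (s, p)"
  using assms
  by (cases p; cases s; cases t; cases u) (auto simp: Let_def split: if_splits)

lemma sum_pair_support:
  fixes F :: "'a \<Rightarrow> 'a \<Rightarrow> 'b::comm_monoid_add"
  assumes "finite A" "p \<in> A" "s \<in> A"
    and supp: "\<And>t u. F t u \<noteq> 0 \<Longrightarrow> (t, u) = (p, s) \<or> (t, u) = (s, p)"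
  shows "(\<Sum>t\<in>A. \<Sum>u\<in>A. F t u) = F p s + (if p = s then 0 else F s p)"
proof -
  have "(\<Sum>t\<in>A. \<Sum>u\<in>A. F t u) = (\<Sum>(t, u)\<in>A \<times> A. F t u)"
    by (simp add: sum.cartesian_product)
  also have "\<dots> = (\<Sum>(t, u)\<in>{(p, s), (s, p)}. F t u)"
  proof (rule sum.mono_neutral_right)
    show "\<forall>i\<in>A \<times> A - {(p, s), (s, p)}. (case i of (t, u) \<Rightarrow> F t u) = 0"
      using supp by (clarsimp, blast)
  qed (use assms(1-3) in auto)
  also have "\<dots> = F p s + (if p = s then 0 else F s p)"
    by auto
  finally show ?thesis .
qed

lemma finite_dspins: "finite (dspins n)"
  by (simp add: dspins_def)

lemma sum_R_left:
  assumes "p \<in> dspins n" "s \<in> dspins n"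
  shows "(\<Sum>t\<in>dspins n. \<Sum>u\<in>dspins n. R_weight n v g zi zj p s t u * C t u) =
    R_weight n v g zi zj p s p s * C p s + (if p = s then 0 else R_weight n v g zi zj p s s p * C s p)"
proof (rule sum_pair_support[OF finite_dspins assms])
  fix t u assume "R_weight n v g zi zj p s t u * C t u \<noteq> 0"
  then show "(t, u) = (p, s) \<or> (t, u) = (s, p)" using R_weight_conserves[of n v g zi zj p s t u] by simp
qed

lemma sum_R_right:
  assumes "t \<in> dspins n" "u \<in> dspins n"
  shows "(\<Sum>p\<in>dspins n. \<Sum>s\<in>dspins n. C p s * R_weight n v g zi zj p s t u) =
    C t u * R_weight n v g zi zj t u t u + (if t = u then 0 else C u t * R_weight n v g zi zj u t t u)"
proof (rule sum_pair_support[OF finite_dspins assms])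
  fix p s assume "C p s * R_weight n v g zi zj p s t u \<noteq> 0"
  then show "(p, s) = (t, u) \<or> (p, s) = (u, t)"
    using R_weight_conserves[of n v g zi zj p s t u] by auto
qed

section \<open>Labels and cyclic successors\<close>

text \<open>
  The bounds are packed into a predicate so that the simplifier can discharge them from an assumption
  without rewriting them together with the other inequalities between labels.
\<close>

definition label :: "nat \<Rightarrow> int \<Rightarrow> bool" where
  "label n a \<longleftrightarrow> 1 \<le> a \<and> a \<le> int n"

definition cyc_succ :: "nat \<Rightarrow> int \<Rightarrow> int" where
  "cyc_succ n a = (if a = int n then 1 else a + 1)"

lemma label_bounds:
  assumes "label n a"
  shows "\<not> int n < a" "a < int n \<longleftrightarrow> a \<noteq> int n"
  using assms by (auto simp: label_def)

lemma label_cong_iff: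
  assumes "label n a" "label n b"
  shows "[a = b] (mod int n) \<longleftrightarrow> a = b"
proof
  assume "[a = b] (mod int n)"
  then have "[a - 1 = b - 1] (mod int n)" by (simp add: cong_diff)
  then show "a = b"
    using assms cong_less_imp_eq_int[of "a - 1" "int n" "b - 1"] by (simp add: label_def)
qed simp

lemma label_cong_0_iff:
  assumes "label n a"
  shows "[a = 0] (mod int n) \<longleftrightarrow> a = int n"
proof -
  have "label n (int n)" using assms by (simp add: label_def)
  with label_cong_iff[OF assms this] show ?thesis by (simp add: cong_def)
qed

lemma label_cyc_succ: "label n a \<Longrightarrow> label n (cyc_succ n a)"
  by (auto simp: label_def cyc_succ_def)

lemma cyc_succ_eq_iff:
  assumes "label n a" "label n b"
  shows "cyc_succ n a = cyc_succ n b \<longleftrightarrow> a = b"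
  using assms by (auto simp: label_def cyc_succ_def)

lemma cyc_succ_less_iff:
  assumes "label n a" "label n b"
  shows "cyc_succ n a < cyc_succ n b \<longleftrightarrow> b \<noteq> int n \<and> (a = int n \<or> a < b)"
  using assms by (auto simp: label_def cyc_succ_def)

lemma cyc_succ_cong: "[cyc_succ n a = a + 1] (mod int n)"
  by (auto simp: cyc_succ_def cong_def)

lemma cyc_succ_surj:
  assumes "label n b"
  obtains a where "label n a" "b = cyc_succ n a"
proof (cases "b = 1")
  case True
  with assms show ?thesis by (intro that[of "int n"]) (auto simp: label_def cyc_succ_def)
next
  case False
  with assms show ?thesis by (intro that[of "b - 1"]) (auto simp: label_def cyc_succ_def)
qed

lemma cyc_succ_cong_succ_iff:
  assumes "label n a" "label n b"
  shows "[cyc_succ n b = a + 1] (mod int n) \<longleftrightarrow> b = a"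
proof -
  have "[cyc_succ n b = a + 1] (mod int n) \<longleftrightarrow> [b + 1 = a + 1] (mod int n)"
    using cyc_succ_cong by (meson cong_sym cong_trans)
  also have "\<dots> \<longleftrightarrow> b = a"
    using label_cong_iff[OF assms(2,1)] by (simp add: cong_add_rcancel)
  finally show ?thesis .
qed

lemma cyc_succ_cong_1_iff:
  assumes "label n b"
  shows "[cyc_succ n b = 1] (mod int n) \<longleftrightarrow> b = int n"
proof -
  have "label n 1" using assms by (simp add: label_def)
  with label_cong_iff[OF label_cyc_succ[OF assms] this] assms show ?thesis
    by (auto simp: label_def cyc_succ_def)
qed

lemma dspins_cases:
  assumes "r \<in> dspins n"
  obtains (Minus) "r = Minus_dec" | (Plus) a where "label n a" "r = Plus_dec a"
  using assms by (auto simp: dspins_def label_def)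

lemma dspins_succ_cases:
  assumes "r \<in> dspins n"
  obtains (Minus) "r = Minus_dec" | (Plus) a where "label n a" "r = Plus_dec (cyc_succ n a)"
  using assms by (metis dspins_cases cyc_succ_surj)

lemma periodic_cong:
  fixes g :: "int \<Rightarrow> 'a"
  assumes per: "\<And>t. g (t + int n) = g t" and "[s = t] (mod int n)"
  shows "g s = g t"
proof -
  have up: "g (t + int n * int k) = g t" for t k
  proof (induction k)
    case (Suc k)
    then show ?case using per[of "t + int n * int k"] by (simp add: algebra_simps)
  qed simp
  obtain k where k: "t = s + int n * k"
    using assms(2) by (auto simp: cong_iff_lin mult.commute)
  show ?thesis
  proof (cases "k \<ge> 0")
    case True
    then show ?thesis using up[of s "nat k"] k by simp
  next
    case False
    then show ?thesis using up[of t "nat (- k)"] k by simp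
  qed
qed

section \<open>The weights in terms of labels\<close>

lemma powi_minus_nat: "(z::complex) powi (- int n) = 1 / z ^ n"
  by (simp add: power_int_def power_inverse divide_inverse)

lemma T_weight_plus:
  assumes "label n a" "label n b"
  shows
    "T_weight n v g z (Plus_dec (cyc_succ n b)) Plus_spin (Plus_dec a) Plus_spin =
       (if b = a then if a = int n then 1 / z ^ n else 1 else 0)"
    "T_weight n v g z (Plus_dec (cyc_succ n b)) Minus_spin (Plus_dec a) Minus_spin =
       (if b = a then g a * (if a = int n then 1 / z ^ n else 1) else 0)"
  using assms label_cong_0_iff[of n a] powi_minus_nat[of z n]
  by (simp_all add: cyc_succ_cong_succ_iff divind_def)

lemma T_weight_mixed:
  assumes "label n a"
  shows
    "T_weight n v g z Minus_dec Plus_spin (Plus_dec a) Minus_spin =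
       (if a = int n then (1 - v) / z ^ n else 0)"
    "T_weight n v g z (Plus_dec (cyc_succ n a)) Minus_spin Minus_dec Plus_spin =
       (if a = int n then 1 else 0)"
  using assms label_cong_0_iff[of n a] cyc_succ_cong_1_iff[of n a] powi_minus_nat[of z n]
  by simp_all

lemma T_weight_constant:
  "T_weight n v g z (Plus_dec b) Plus_spin r Minus_spin = 0"
  "T_weight n v g z (Plus_dec b) Plus_spin Minus_dec d = 0"
  "T_weight n v g z (Plus_dec b) Minus_spin (Plus_dec a) Plus_spin = 0"
  "T_weight n v g z (Plus_dec b) Minus_spin Minus_dec Minus_spin = 0"
  "T_weight n v g z Minus_dec Minus_spin r Plus_spin = 0"
  "T_weight n v g z Minus_dec Minus_spin (Plus_dec a) d = 0"
  "T_weight n v g z Minus_dec Plus_spin (Plus_dec a) Plus_spin = 0"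
  "T_weight n v g z Minus_dec Plus_spin Minus_dec Minus_spin = 0"
  "T_weight n v g z Minus_dec Plus_spin Minus_dec Plus_spin = 1"
  "T_weight n v g z Minus_dec Minus_spin Minus_dec Minus_spin = 1"
  subgoal by (cases r) simp_all
  subgoal by (cases d) simp_all
  subgoal by simp
  subgoal by simp
  subgoal by (cases r) simp_all
  subgoal by (cases d) simp_all
  by simp_all

lemma R_weight_keep:
  fixes a b :: int
  assumes x: "(zi / zj) ^ n = x" and h: "1 - v * x = h"
  shows
    "R_weight n v g zi zj (Plus_dec a) (Plus_dec b) (Plus_dec a) (Plus_dec b) =
       (if a = b then x - v else if b < a then (1 - v) * x else 1 - v) / h"
    "R_weight n v g zi zj (Plus_dec a) Minus_dec (Plus_dec a) Minus_dec = (1 - v) * x / h"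
    "R_weight n v g zi zj Minus_dec (Plus_dec a) Minus_dec (Plus_dec a) = (1 - v) / h"
    "R_weight n v g zi zj Minus_dec Minus_dec Minus_dec Minus_dec = 1"
  unfolding R_weight.simps Let_def x h by (cases a b rule: linorder_cases; simp)+

lemma R_weight_exchange:
  fixes a b :: int
  assumes x: "(zi / zj) ^ n = x" and h: "1 - v * x = h"
  shows
    "a \<noteq> b \<Longrightarrow> R_weight n v g zi zj (Plus_dec a) (Plus_dec b) (Plus_dec b) (Plus_dec a) =
       g (a - b) * (1 - x) / h"
    "R_weight n v g zi zj Minus_dec (Plus_dec a) (Plus_dec a) Minus_dec = v * (1 - x) / h"
    "R_weight n v g zi zj (Plus_dec a) Minus_dec Minus_dec (Plus_dec a) = (1 - x) / h"
  unfolding R_weight.simps Let_def x h by (cases a b rule: linorder_cases; simp)+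

section \<open>The identity sector by sector\<close>

text \<open>
  The partition function of two stacked \<open>T\<close>-vertices, the upper one with parameter \<open>z\<close> and horizontal
  edges \<open>p\<close>, \<open>t\<close>, the lower one with parameter \<open>w\<close> and horizontal edges \<open>s\<close>, \<open>u\<close>.
\<close>

definition column ::
  "nat \<Rightarrow> complex \<Rightarrow> (int \<Rightarrow> complex) \<Rightarrow> complex \<Rightarrow> complex \<Rightarrow>
     dspin \<Rightarrow> dspin \<Rightarrow> spin \<Rightarrow> dspin \<Rightarrow> dspin \<Rightarrow> spin \<Rightarrow> complex" where
  "column n v g z w p s b t u a =
     T_weight n v g z p b t Plus_spin * T_weight n v g w s Plus_spin u a
   + T_weight n v g z p b t Minus_spin * T_weight n v g w s Minus_spin u a"

text \<open>
  The quantities \<open>x\<close>, \<open>h\<close> and \<open>y\<close> are parameters rather than abbreviations, so that clearing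
  denominators treats them as atoms. The spectral parameters \<open>zi\<close> and \<open>zj\<close> enter the weights only
  through \<open>zi^n = x y\<close> and \<open>zj^n = y\<close>.
\<close>

locale two_rows =
  fixes n :: nat and v zi zj :: complex and g :: "int \<Rightarrow> complex" and x h y :: complex
  assumes g_periodic: "\<And>t. g (t + int n) = g t"
    and g_0: "g 0 = - v"
    and g_mult: "\<And>t. \<not> [t = 0] (mod int n) \<Longrightarrow> g t * g (int n - t) = v"
    and nonzero: "x \<noteq> 0" "y \<noteq> 0" "h \<noteq> 0"
    and x: "(zi / zj) ^ n = x" and h: "1 - v * x = h"
    and zj: "zj ^ n = y" and zi: "zi ^ n = x * y"
begin

lemma g_n: "g (int n) = - v"
  using g_periodic[of 0] g_0 by simp

lemma g_minus_n: "g (a - int n) = g a"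
  using g_periodic[of "a - int n"] by simp

lemma g_diff_cyc_succ: "g (cyc_succ n a - cyc_succ n b) = g (a - b)"
  by (rule periodic_cong, rule g_periodic)
    (use cong_diff[OF cyc_succ_cong cyc_succ_cong, of n a b] in simp)

lemma g_mult_label: "g a * g (int n - a) = v" if "label n a" "a \<noteq> int n"
  using g_mult[of a] that label_cong_0_iff[of n a] by simp

text \<open>
  The two partition functions, each reduced to the terms that survive conservation of labels at the
  \<open>R\<close>-vertex. The equality tests keep a repeated label from being counted twice.
\<close>

definition R_on_left :: "dspin \<Rightarrow> dspin \<Rightarrow> spin \<Rightarrow> dspin \<Rightarrow> dspin \<Rightarrow> spin \<Rightarrow> complex" where
  "R_on_left p s b t u a =
     R_weight n v g zi zj p s p s * column n v g zj zi p s b t u a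
   + (if p = s then 0 else R_weight n v g zi zj p s s p * column n v g zj zi s p b t u a)"

definition R_on_right :: "dspin \<Rightarrow> dspin \<Rightarrow> spin \<Rightarrow> dspin \<Rightarrow> dspin \<Rightarrow> spin \<Rightarrow> complex" where
  "R_on_right p s b t u a =
     column n v g zi zj p s b t u a * R_weight n v g zi zj t u t u
   + (if t = u then 0 else column n v g zi zj p s b u t a * R_weight n v g zi zj u t t u)"

lemmas weights = R_on_left_def R_on_right_def column_def
  T_weight_plus T_weight_mixed T_weight_constant
  R_weight_keep[OF x h] R_weight_exchange[OF x h]
  cyc_succ_eq_iff cyc_succ_less_iff g_diff_cyc_succ zi zj

lemmas label_rules = nonzero g_n g_minus_n g_mult_label label_bounds

text \<open>
  In each sector the weights are expanded through their description by labels, the recursion equations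
  being switched off. Part of the resulting rational identities hold for any nonzero \<open>h\<close>; the others
  need \<open>h = 1 - v x\<close>, which is substituted only after \<open>h\<close> has been cleared from the denominators.
\<close>

lemma exchange_minus_minus:
  assumes "t \<in> dspins n" "u \<in> dspins n"
  shows "R_on_left Minus_dec Minus_dec b t u a = R_on_right Minus_dec Minus_dec b t u a"
  using assms
  apply (elim dspins_cases; cases a; cases b)
  apply (simp_all add: weights del: R_weight.simps T_weight.simps)
  apply (auto simp: label_rules field_simps)
  apply (simp_all add: algebra_simps flip: h)
  done

lemma exchange_minus_plus:
  assumes "label n s" "t \<in> dspins n" "u \<in> dspins n"
  shows "R_on_left Minus_dec (Plus_dec (cyc_succ n s)) b t u a =
    R_on_right Minus_dec (Plus_dec (cyc_succ n s)) b t u a"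
  using assms
  apply (elim dspins_cases; cases a; cases b)
  apply (simp_all add: weights del: R_weight.simps T_weight.simps)
  apply (auto simp: label_rules field_simps)
  apply (simp_all add: algebra_simps flip: h)
  done

lemma exchange_plus_minus:
  assumes "label n p" "t \<in> dspins n" "u \<in> dspins n"
  shows "R_on_left (Plus_dec (cyc_succ n p)) Minus_dec b t u a =
    R_on_right (Plus_dec (cyc_succ n p)) Minus_dec b t u a"
  using assms
  apply (elim dspins_cases; cases a; cases b)
  apply (simp_all add: weights del: R_weight.simps T_weight.simps)
  apply (auto simp: label_rules field_simps)
  apply (simp_all add: algebra_simps flip: h)
  done

lemma exchange_plus_plus:
  assumes "label n p" "label n s" "t \<in> dspins n" "u \<in> dspins n"
  shows "R_on_left (Plus_dec (cyc_succ n p)) (Plus_dec (cyc_succ n s)) b t u a =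
    R_on_right (Plus_dec (cyc_succ n p)) (Plus_dec (cyc_succ n s)) b t u a"
  using assms
  apply (elim dspins_cases; cases a; cases b)
  apply (simp_all add: weights del: R_weight.simps T_weight.simps)
  apply (auto simp: label_rules field_simps)
  done

lemma exchange:
  assumes "p \<in> dspins n" "s \<in> dspins n" "t \<in> dspins n" "u \<in> dspins n"
  shows "R_on_left p s b t u a = R_on_right p s b t u a"
  using assms(1,2)
  by (elim dspins_succ_cases)
    (simp_all add: assms(3,4) exchange_minus_minus exchange_minus_plus exchange_plus_minus
      exchange_plus_plus)

end

theorem theorem5p5:
  fixes n :: nat and v zi zj :: complex and g :: "int \<Rightarrow> complex"
    and \<sigma> \<tau> \<theta> \<rho> :: dspin and \<alpha> \<beta> :: spin
  assumes "n \<ge> 1"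
    and "\<And>t. g (t + int n) = g t"
    and "g 0 = - v"
    and "\<And>t. \<not> [t = 0] (mod int n) \<Longrightarrow> g t * g (int n - t) = v"
    and "zi \<noteq> 0" and "zj \<noteq> 0"
    and "1 - v * (zi / zj) ^ n \<noteq> 0"
    and "\<sigma> \<in> dspins n" and "\<tau> \<in> dspins n" and "\<theta> \<in> dspins n" and "\<rho> \<in> dspins n"
  shows "(\<Sum>\<nu>\<in>dspins n. \<Sum>\<mu>\<in>dspins n. \<Sum>\<gamma>\<in>{Plus_spin, Minus_spin}.
            R_weight n v g zi zj \<tau> \<sigma> \<nu> \<mu> * T_weight n v g zj \<nu> \<beta> \<theta> \<gamma> * T_weight n v g zi \<mu> \<gamma> \<rho> \<alpha>)
       = (\<Sum>\<phi>\<in>dspins n. \<Sum>\<psi>\<in>dspins n. \<Sum>\<delta>\<in>{Plus_spin, Minus_spin}.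
            T_weight n v g zi \<tau> \<beta> \<phi> \<delta> * T_weight n v g zj \<sigma> \<delta> \<psi> \<alpha> * R_weight n v g zi zj \<phi> \<psi> \<theta> \<rho>)"
    (is "?L = ?R")
proof -
  interpret two_rows n v zi zj g "(zi / zj) ^ n" "1 - v * (zi / zj) ^ n" "zj ^ n"
    by (unfold_locales; (fact assms | simp add: assms power_divide))
  have "?L = (\<Sum>\<nu>\<in>dspins n. \<Sum>\<mu>\<in>dspins n.
      R_weight n v g zi zj \<tau> \<sigma> \<nu> \<mu> * column n v g zj zi \<nu> \<mu> \<beta> \<theta> \<rho> \<alpha>)"
    unfolding column_def by (simp only: distrib_left mult.assoc) simp
  also have "\<dots> = R_on_left \<tau> \<sigma> \<beta> \<theta> \<rho> \<alpha>"
    unfolding R_on_left_def by (rule sum_R_left[OF assms(9,8)])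
  also have "\<dots> = R_on_right \<tau> \<sigma> \<beta> \<theta> \<rho> \<alpha>"
    by (rule exchange[OF assms(9,8,10,11)])
  also have "\<dots> = (\<Sum>\<phi>\<in>dspins n. \<Sum>\<psi>\<in>dspins n.
      column n v g zi zj \<tau> \<sigma> \<beta> \<phi> \<psi> \<alpha> * R_weight n v g zi zj \<phi> \<psi> \<theta> \<rho>)"
    unfolding R_on_right_def by (rule sum_R_right[OF assms(10,11), symmetric])
  also have "\<dots> = ?R"
    unfolding column_def by (simp only: distrib_right) simp
  finally show ?thesis .
qed

end
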